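(* For every integer $n\ge 1$, $$\sum_{r=1}^{n}\frac{E_{2r}}{(2r-1)!\,(2(n-r+1))!}=2\sum_{r=1}^{n}\sum_{k=1}^{r}\frac{\left(2^{2k}-1\right)B_{2k}\,E_{2(r-k+1)}}{(2k)!\,(2(n-r)+1)!\,(2(r-k)+1)!}.$$
   Context: The Bernoulli numbers $B_m$ are defined by $\frac{x}{e^x-1}=\sum_{m=0}^\infty B_m\frac{x^m}{m!}$ for $|x|<2\pi$. The Euler numbers $E_m$ are defined by $\frac{1}{\cosh t}=\sum_{m=0}^\infty E_m\frac{t^m}{m!}$ for $|t|<\pi/2$. *)

theory Defs
  imports "HOL-Complex_Analysis.Complex_Analysis"
begin

(* At x = 0 the library has x / (exp x - 1) = 0 / 0 = 0, whereas the function meant there is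
   the continuous extension, with value 1; hence 0 is excluded. This does not affect
   uniqueness, see bernoulli_unique. *)
definition bernoulli :: "nat \<Rightarrow> real" where
  "bernoulli = (THE B. \<forall>x::real. x \<noteq> 0 \<and> \<bar>x\<bar> < 2 * pi \<longrightarrow>
     (\<lambda>m. B m * (x ^ m / fact m)) sums (x / (exp x - 1)))"

definition euler :: "nat \<Rightarrow> real" where
  "euler = (THE E. \<forall>t::real. \<bar>t\<bar> < pi / 2 \<longrightarrow>
     (\<lambda>m. E m * (t ^ m / fact m)) sums (1 / cosh t))"

(* Both descriptions are proper: such sequences exist and are unique. *)

lemma egf_coeffs_unique:
  fixes a b :: "nat \<Rightarrow> real"
  assumes r: "0 < r"
    and a: "\<And>x. x \<noteq> 0 \<Longrightarrow> \<bar>x\<bar> < r \<Longrightarrow> (\<lambda>m. a m * (x ^ m / fact m)) sums f x"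
    and b: "\<And>x. x \<noteq> 0 \<Longrightarrow> \<bar>x\<bar> < r \<Longrightarrow> (\<lambda>m. b m * (x ^ m / fact m)) sums f x"
  shows "a = b"
proof -
  define d where "d m = (a m - b m) / fact m" for m
  have d: "(\<lambda>m. d m * x ^ m) sums 0" if "x \<noteq> 0" "\<bar>x\<bar> < r" for x
    using sums_diff[OF a[OF that] b[OF that]] by (simp add: d_def field_simps)
  have "((\<lambda>x::real. 0::real) \<longlongrightarrow> d 0) (at 0)"
    by (rule powser_limit_0_strong[OF r]) (use d in auto)
  then have d0: "d 0 = 0"
    by (simp add: tendsto_const_iff)
  have dm: "d m = 0" if "m > 0" for m
  proof (rule ccontr)
    assume nz: "d m \<noteq> 0"
    have sm: "(\<lambda>n. d n * (x - 0) ^ n) sums 0" if "norm (x - 0) < r" for x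
      using d[of x] that powser_sums_zero[of d] d0 by (cases "x = 0") auto
    show False
    proof (rule powser_0_nonzero[of r 0 d "\<lambda>_. 0" m, OF r sm refl nz that])
      fix s :: real
      assume s: "0 < s" "\<And>z::real. z \<in> cball 0 s - {0} \<Longrightarrow> (0::real) \<noteq> 0"
      have "s \<in> cball 0 s - {0}"
        using s(1) by simp
      from s(2)[OF this] show False
        by simp
    qed
  qed
  have "d m = 0" for m
    using d0 dm[of m] by (cases "m = 0") auto
  then show ?thesis
    by (auto simp: d_def fun_eq_iff)
qed

lemma egf_coeffs_exist:
  fixes f :: "complex \<Rightarrow> complex" and g :: "real \<Rightarrow> real"
  assumes hol: "f holomorphic_on ball 0 r"
    and eq: "\<And>x. P x \<Longrightarrow> \<bar>x\<bar> < r \<Longrightarrow> f (of_real x) = of_real (g x)"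
  shows "\<exists>a. \<forall>x::real. P x \<and> \<bar>x\<bar> < r \<longrightarrow> (\<lambda>m. a m * (x ^ m / fact m)) sums g x"
proof (intro exI allI impI)
  fix x :: real
  assume x: "P x \<and> \<bar>x\<bar> < r"
  have "(\<lambda>n. (deriv ^^ n) f 0 / fact n * (of_real x - 0) ^ n) sums f (of_real x)"
    by (rule holomorphic_power_series[OF hol]) (use x in auto)
  from sums_Re[OF this]
  have "(\<lambda>n. Re ((deriv ^^ n) f 0 / fact n * (of_real x - 0) ^ n)) sums g x"
    using x by (simp add: eq)
  also have "(\<lambda>n. Re ((deriv ^^ n) f 0 / fact n * (of_real x - 0) ^ n)) =
             (\<lambda>n. Re ((deriv ^^ n) f 0) * (x ^ n / fact n))"
  proof
    fix n
    have "(deriv ^^ n) f 0 / fact n * (of_real x - 0) ^ n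
        = (deriv ^^ n) f 0 * complex_of_real (x ^ n / fact n)"
      by simp
    then show "Re ((deriv ^^ n) f 0 / fact n * (of_real x - 0) ^ n) =
             Re ((deriv ^^ n) f 0) * (x ^ n / fact n)"
      by (simp only: times_complex.sel Re_complex_of_real Im_complex_of_real mult_zero_right diff_0_right)
  qed
  finally show "(\<lambda>m. Re ((deriv ^^ m) f 0) * (x ^ m / fact m)) sums g x" .
qed

lemma bernoulli_exists:
  "\<exists>B. \<forall>x::real. x \<noteq> 0 \<and> \<bar>x\<bar> < 2 * pi \<longrightarrow>
     (\<lambda>m. B m * (x ^ m / fact m)) sums (x / (exp x - 1))"
proof (rule egf_coeffs_exist)
  have nz: "exp z \<noteq> 1" if "z \<in> ball 0 (2 * pi) - {0}" for z :: complex
  proof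
    assume "exp z = 1"
    then obtain n :: int where n: "Re z = 0" "Im z = of_int (2 * n) * pi"
      by (auto simp: exp_eq_1)
    have "\<bar>Im z\<bar> < 2 * pi"
      using that abs_Im_le_cmod[of z] by auto
    then have "\<bar>real_of_int n\<bar> * (2 * pi) < 1 * (2 * pi)"
      by (simp add: n abs_mult mult_ac)
    then have "\<bar>real_of_int n\<bar> < 1"
      by (simp only: mult_less_cancel_right) auto
    then have "n = 0"
      by linarith
    with n that show False
      by (simp add: complex_eq_iff)
  qed
  have "((\<lambda>z::complex. (exp z - 1) / z) \<longlongrightarrow> 1) (at 0)"
    using DERIV_exp[of "0::complex"] by (simp add: DERIV_def)
  from tendsto_inverse[OF this]
  have lim: "((\<lambda>z::complex. z / (exp z - 1)) \<longlongrightarrow> 1) (at 0)"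
    by (simp add: inverse_eq_divide)
  show "(\<lambda>z::complex. if z = 0 then 1 else z / (exp z - 1)) holomorphic_on ball 0 (2 * pi)"
    by (rule removable_singularity[OF _ _ lim]) (use nz in \<open>auto intro!: holomorphic_intros\<close>)
qed (auto simp flip: exp_of_real)

lemma euler_exists:
  "\<exists>E. \<forall>t::real. \<bar>t\<bar> < pi / 2 \<longrightarrow>
     (\<lambda>m. E m * (t ^ m / fact m)) sums (1 / cosh t)"
proof -
  have nz: "cosh z \<noteq> 0" if "z \<in> ball 0 (pi / 2)" for z :: complex
  proof
    assume "cosh z = 0"
    then have "exp z + exp (- z) = 0"
      by (simp add: cosh_def)
    then have "(exp z + exp (- z)) * exp z = 0"
      by (simp only: mult_zero_left)
    moreover have "exp (- z) * exp z = 1"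
      by (simp add: exp_minus)
    ultimately have "exp z * exp z + 1 = 0"
      by (simp only: distrib_right)
    moreover have "exp (2 * z) = exp z * exp z"
      by (simp only: mult_2 exp_add)
    ultimately have "exp (2 * z) = - 1"
      by (simp only: eq_neg_iff_add_eq_0)
    then have "exp (2 * z + \<i> * pi) = 1"
      by (simp add: exp_add)
    then obtain n :: int where n: "2 * Im z + pi = of_int (2 * n) * pi"
      by (auto simp: exp_eq_1)
    have "\<bar>Im z\<bar> < pi / 2"
      using that abs_Im_le_cmod[of z] by auto
    then have "0 < 2 * Im z + pi" "2 * Im z + pi < 2 * pi"
      by linarith+
    then have "0 * pi < real_of_int (2 * n) * pi" "real_of_int (2 * n) * pi < 2 * pi"
      unfolding n by auto
    then have "0 < real_of_int (2 * n)" "real_of_int (2 * n) < 2"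
      using pi_gt_zero mult_less_cancel_right_pos by blast+
    then have "0 < 2 * n" "2 * n < 2"
      by simp_all
    then show False
      by presburger
  qed
  have "\<exists>E. \<forall>t::real. True \<and> \<bar>t\<bar> < pi / 2 \<longrightarrow>
     (\<lambda>m. E m * (t ^ m / fact m)) sums (1 / cosh t)"
  proof (rule egf_coeffs_exist)
    show "(\<lambda>z::complex. 1 / cosh z) holomorphic_on ball 0 (pi / 2)"
      using nz unfolding cosh_def by (auto intro!: holomorphic_intros)
  next
    fix x :: real
    have "cosh (complex_of_real x) = complex_of_real (cosh x)"
      by (simp add: cosh_def scaleR_conv_of_real flip: exp_of_real)
    then show "1 / cosh (complex_of_real x) = complex_of_real (1 / cosh x)"
      by simp
  qed
  then show ?thesis
    by simp
qed

lemma bernoulli_unique: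
  assumes "\<And>x::real. x \<noteq> 0 \<Longrightarrow> \<bar>x\<bar> < 2 * pi \<Longrightarrow>
     (\<lambda>m. B m * (x ^ m / fact m)) sums (x / (exp x - 1))"
  shows "bernoulli = B"
  unfolding bernoulli_def
proof (rule the_equality)
  fix C :: "nat \<Rightarrow> real"
  assume C: "\<forall>x::real. x \<noteq> 0 \<and> \<bar>x\<bar> < 2 * pi \<longrightarrow>
     (\<lambda>m. C m * (x ^ m / fact m)) sums (x / (exp x - 1))"
  show "C = B"
    by (rule egf_coeffs_unique[of "2 * pi" _ "\<lambda>x. x / (exp x - 1)"]) (use assms C in auto)
qed (use assms in auto)

lemma euler_unique:
  assumes "\<And>t::real. \<bar>t\<bar> < pi / 2 \<Longrightarrow>
     (\<lambda>m. E m * (t ^ m / fact m)) sums (1 / cosh t)"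
  shows "euler = E"
  unfolding euler_def
proof (rule the_equality)
  fix C :: "nat \<Rightarrow> real"
  assume C: "\<forall>t::real. \<bar>t\<bar> < pi / 2 \<longrightarrow>
     (\<lambda>m. C m * (t ^ m / fact m)) sums (1 / cosh t)"
  show "C = E"
    by (rule egf_coeffs_unique[of "pi / 2" _ "\<lambda>t. 1 / cosh t"]) (use assms C in auto)
qed (use assms in auto)

lemma bernoulli_sums:
  fixes x :: real
  assumes "x \<noteq> 0" "\<bar>x\<bar> < 2 * pi"
  shows "(\<lambda>m. bernoulli m * (x ^ m / fact m)) sums (x / (exp x - 1))"
proof -
  obtain B where B: "\<forall>x::real. x \<noteq> 0 \<and> \<bar>x\<bar> < 2 * pi \<longrightarrow>
      (\<lambda>m. B m * (x ^ m / fact m)) sums (x / (exp x - 1))"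
    using bernoulli_exists ..
  then have "bernoulli = B"
    by (intro bernoulli_unique) simp
  then show ?thesis
    using B assms by simp
qed

lemma euler_sums:
  fixes t :: real
  assumes "\<bar>t\<bar> < pi / 2"
  shows "(\<lambda>m. euler m * (t ^ m / fact m)) sums (1 / cosh t)"
proof -
  obtain E where E: "\<forall>t::real. \<bar>t\<bar> < pi / 2 \<longrightarrow>
      (\<lambda>m. E m * (t ^ m / fact m)) sums (1 / cosh t)"
    using euler_exists ..
  then have "euler = E"
    by (intro euler_unique) simp
  then show ?thesis
    using E assms by simp
qed

end

theory Submission
  imports Defs
begin

text \<open>
  For each \<open>j\<close>, collect the terms of the right-hand side that contain \<open>E\<^bsub>2j\<^esub>\<close>, i.e. those with
  \<open>r - k + 1 = j\<close>. With \<open>m = n - j + 1\<close>, comparing the factor of \<open>E\<^bsub>2j\<^esub> / (2j - 1)!\<close> on both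
  sides leaves the identity between Bernoulli numbers
  \[ 2 \sum_{k=1}^m \frac{(2^{2k} - 1) B_{2k}}{(2k)!\,(2(m-k)+1)!} = \frac{1}{(2m)!}, \]
  proved below as \<open>bernoulli_sinh_convolution\<close>. It is the coefficient of \<open>t\<^bsup>2m+1\<^esup>\<close> in
  \[ 2 \cdot \frac t2 \tanh \frac t2 \cdot \sinh t = t\,(\cosh t - 1), \]
  because \<open>(t/2) tanh (t/2)\<close> is the even part of \<open>b(2t) - b(t)\<close>, where
  \<open>b(t) = t / (exp t - 1)\<close> is the generating function of the Bernoulli numbers.
  In terms of generating functions, the theorem is this identity, divided by \<open>t\<close> and multiplied by
  the derivative of \<open>1 / cosh t\<close>.
\<close>

definition bernoulli_fps :: "real fps" where
  "bernoulli_fps = Abs_fps (\<lambda>m. bernoulli m / fact m)"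

text \<open>
  The Bernoulli numbers are given through convergent real series, whereas the manipulations
  below (substituting \<open>2t\<close> and \<open>-t\<close>, cancelling factors) are purely formal. This lemma is the
  bridge between the two: a power series is determined by its values near the origin.
\<close>

lemma bernoulli_fps_times_exp_minus_1: "bernoulli_fps * (fps_exp 1 - 1) = fps_X"
proof -
  let ?P = "bernoulli_fps * (fps_exp 1 - 1)"
  have summable: "summable (\<lambda>m. fps_nth bernoulli_fps m * x ^ m)"
    if "x \<noteq> 0" "\<bar>x\<bar> < 2 * pi" for x
    using bernoulli_sums[OF that] by (simp add: bernoulli_fps_def sums_iff field_simps)
  have radius_ge: "norm (pi :: real) \<le> fps_conv_radius bernoulli_fps"
    unfolding fps_conv_radius_def by (rule conv_radius_geI) (use summable[of pi] in simp)
  have radius: "ereal \<bar>x\<bar> < fps_conv_radius bernoulli_fps" if "\<bar>x\<bar> < pi" for x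
    by (rule less_le_trans[OF _ radius_ge]) (use that in simp)
  have P: "(\<lambda>m. (fps_nth ?P m * fact m) * (x ^ m / fact m)) sums x"
    if x: "x \<noteq> 0" "\<bar>x\<bar> < pi" for x
  proof -
    have "eval_fps bernoulli_fps x = x / (exp x - 1)"
      using bernoulli_sums[of x] x
      by (simp add: eval_fps_def bernoulli_fps_def sums_iff field_simps)
    moreover have "eval_fps (fps_exp 1 - 1) x = exp x - 1"
      by (subst eval_fps_diff) auto
    moreover have "exp x \<noteq> 1"
      using x by simp
    moreover have "(fps_conv_radius (fps_exp 1 - 1 :: real fps)) = \<infinity>"
      using fps_conv_radius_diff[of "fps_exp 1 :: real fps" 1] by simp
    ultimately have "eval_fps ?P x = x"
      by (subst eval_fps_mult) (use radius[OF x(2)] in auto)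
    moreover have "ereal (norm x) < fps_conv_radius ?P"
      using radius[OF x(2)] fps_conv_radius_mult[of bernoulli_fps "fps_exp 1 - 1 :: real fps"]
        \<open>fps_conv_radius (fps_exp 1 - 1 :: real fps) = \<infinity>\<close>
      by (auto intro: less_le_trans)
    ultimately show ?thesis
      using sums_eval_fps[of x ?P] by simp
  qed
  have X: "(\<lambda>m. (fps_nth fps_X m * fact m) * (x ^ m / fact m)) sums x" for x :: real
    using sums_eval_fps[of x fps_X] by simp
  have "(\<lambda>m. fps_nth ?P m * fact m) = (\<lambda>m. fps_nth fps_X m * fact m)"
    by (rule egf_coeffs_unique[of pi _ "\<lambda>x. x"]) (use P X in auto)
  then show ?thesis
    by (simp add: fps_eq_iff fun_eq_iff)
qed

text \<open>
  The coefficients \<open>2 (2\<^sup>m - 1) B\<^sub>m / m!\<close> for even \<open>m\<close> are those of \<open>t tanh (t/2)\<close>. This series is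
  obtained by adding \<open>T(t) = b(2t) - b(t) = - t / (exp t + 1)\<close> and \<open>T(-t)\<close>, which
  removes the coefficients of odd degree. The denominator of \<open>tanh (t/2) = (exp t - 1) / (exp t + 1)\<close> is then cleared by
  the factor \<open>exp t - exp (-t) = exp (-t) (exp t - 1) (exp t + 1)\<close>.
\<close>

lemma tanh_fps_times_sinh:
  fixes U :: "real fps"
  defines "U \<equiv> Abs_fps (\<lambda>m. (1 + (- 1) ^ m) * ((2 ^ m - 1) * bernoulli m / fact m))"
  shows "U * (fps_exp 1 - fps_exp (- 1)) = fps_X * (fps_exp 1 - 2 + fps_exp (- 1))"
proof -
  define W V :: "real fps" where "W = fps_exp 1" and "V = fps_exp (- 1)"
  have VW: "V * W = 1"
    unfolding V_def W_def by (simp flip: fps_exp_add_mult)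
  define B where "B = bernoulli_fps"
  define B2 where "B2 = B oo (fps_const 2 * fps_X)"
  define T where "T = B2 - B"
  define T' where "T' = T oo (fps_const (- 1) * fps_X)"
  have B: "B * (W - 1) = fps_X"
    using bernoulli_fps_times_exp_minus_1 by (simp add: B_def W_def)
  have "(B * (W - 1)) oo (fps_const 2 * fps_X) = B2 * (fps_exp 2 - 1)"
    by (simp add: fps_compose_mult_distrib fps_compose_sub_distrib B2_def W_def)
  moreover have "fps_exp 2 = W * W"
    unfolding W_def by (simp flip: fps_exp_add_mult)
  ultimately have B2: "B2 * (W * W - 1) = 2 * fps_X"
    by (simp add: B numeral_fps_const)
  have "(T * (W + 1) + fps_X) * (W - 1) = B2 * (W * W - 1) - B * (W - 1) * (W + 1) + fps_X * (W - 1)"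
    by (simp add: T_def algebra_simps)
  also have "\<dots> = 0"
    unfolding B B2 by (simp add: algebra_simps)
  finally have "(T * (W + 1) + fps_X) * (W - 1) = 0" .
  moreover have "W - 1 \<noteq> 0"
    using B by auto
  ultimately have T: "T * (W + 1) = - fps_X"
    by (simp add: eq_neg_iff_add_eq_0)
  have "(T * (W + 1)) oo (fps_const (- 1) * fps_X) = T' * (V + 1)"
    by (subst fps_compose_mult_distrib)
      (simp_all only: fps_compose_add_distrib T'_def W_def V_def fps_exp_compose_linear, simp_all)
  then have T': "T' * (V + 1) = fps_X"
    by (simp add: T fps_compose_uminus flip: fps_const_neg)
  have "fps_nth T m = (2 ^ m - 1) * bernoulli m / fact m" for m
    by (simp add: T_def B2_def B_def bernoulli_fps_def diff_divide_distrib left_diff_distrib)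
  then have U: "U = T + T'"
    unfolding fps_eq_iff U_def T'_def by (simp add: distrib_right add_divide_distrib)
  have "T' * (W + 1) = T' * (V * W + W)"
    by (simp add: VW add.commute)
  also have "\<dots> = T' * (V + 1) * W"
    by (simp add: algebra_simps)
  finally have "T' * (W + 1) = fps_X * W"
    by (simp only: T')
  then have "U * (W + 1) = fps_X * (W - 1)"
    unfolding U distrib_right[of T] T by (simp add: algebra_simps)
  then have "U * (W + 1) * ((W - 1) * V) = fps_X * (W - 1) * ((W - 1) * V)"
    by simp
  moreover have "(W + 1) * ((W - 1) * V) = W - V" "(W - 1) * ((W - 1) * V) = W - 2 + V"
    using VW by (algebra, algebra)
  ultimately show ?thesis
    unfolding W_def[symmetric] V_def[symmetric] by (simp add: mult.assoc)
qed

text \<open>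
  This compares the coefficients of \<open>t\<^bsup>2m+1\<^esup>\<close> in the product above. Only even indices contribute on
  the left, and the index \<open>0\<close> drops out because of the factor \<open>2\<^sup>0 - 1\<close>. For \<open>m \<ge> 1\<close>
  the constant \<open>-2\<close> in \<open>exp t - 2 + exp (-t)\<close> does not enter on the right.
\<close>

lemma bernoulli_sinh_convolution:
  assumes "m \<ge> 1"
  shows "2 * (\<Sum>k = 1..m. (2 ^ (2 * k) - 1) * bernoulli (2 * k) /
           (fact (2 * k) * fact (2 * (m - k) + 1))) = 1 / fact (2 * m)"
proof -
  define u where "u i = (1 + (- 1) ^ i) * ((2 ^ i - 1) * bernoulli i / fact i)" for i
  define s :: "nat \<Rightarrow> real" where "s i = fps_nth (fps_exp 1 - fps_exp (- 1)) i" for i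
  have s: "s (2 * m + 1 - 2 * k) = 2 / fact (2 * (m - k) + 1)" if "k \<le> m" for k
  proof -
    have "2 * m + 1 - 2 * k = 2 * (m - k) + 1"
      using that by simp
    then show ?thesis
      by (simp add: s_def del: fact_Suc)
  qed
  have "(\<Sum>i = 0..2 * m + 1. u i * s (2 * m + 1 - i)) =
      fps_nth (fps_X * (fps_exp 1 - 2 + fps_exp (- 1)) :: real fps) (2 * m + 1)"
    unfolding tanh_fps_times_sinh[symmetric] fps_mult_nth by (simp add: u_def s_def)
  also have "\<dots> = 2 / fact (2 * m)"
    using assms by (simp add: numeral_fps_const)
  finally have "2 / fact (2 * m) = (\<Sum>i = 0..2 * m + 1. u i * s (2 * m + 1 - i))" ..
  also have "\<dots> = (\<Sum>i \<in> (\<lambda>k. 2 * k) ` {1..m}. u i * s (2 * m + 1 - i))"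
  proof (rule sum.mono_neutral_right)
    show "\<forall>i \<in> {0..2 * m + 1} - (\<lambda>k. 2 * k) ` {1..m}. u i * s (2 * m + 1 - i) = 0"
    proof
      fix i
      assume i: "i \<in> {0..2 * m + 1} - (\<lambda>k. 2 * k) ` {1..m}"
      have "i = 0 \<or> odd i"
      proof (rule ccontr)
        assume "\<not> (i = 0 \<or> odd i)"
        then obtain k where "i = 2 * k" "k \<ge> 1"
          by (auto elim!: evenE)
        with i show False
          by auto
      qed
      then show "u i * s (2 * m + 1 - i) = 0"
        by (auto simp: u_def)
    qed
  qed auto
  also have "\<dots> = (\<Sum>k = 1..m. u (2 * k) * s (2 * m + 1 - 2 * k))"
    by (subst sum.reindex) (auto simp: inj_on_def)
  also have "\<dots> = (\<Sum>k = 1..m. 4 * ((2 ^ (2 * k) - 1) * bernoulli (2 * k) /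
      (fact (2 * k) * fact (2 * (m - k) + 1))))"
  proof (rule sum.cong[OF refl])
    fix k
    assume "k \<in> {1..m}"
    then have "s (2 * m + 1 - 2 * k) = 2 / fact (2 * (m - k) + 1)"
      by (intro s) simp
    then show "u (2 * k) * s (2 * m + 1 - 2 * k) = 4 * ((2 ^ (2 * k) - 1) * bernoulli (2 * k) /
        (fact (2 * k) * fact (2 * (m - k) + 1)))"
      by (simp only: u_def) (simp del: fact_Suc)
  qed
  finally have "2 * (1 / fact (2 * m)) = 2 * (2 * (\<Sum>k = 1..m.
      (2 ^ (2 * k) - 1) * bernoulli (2 * k) / (fact (2 * k) * fact (2 * (m - k) + 1))))"
    unfolding sum_distrib_left[symmetric] by simp
  then show ?thesis
    by (simp only: mult_left_cancel[OF zero_neq_numeral[symmetric]])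
qed

lemma sum_triangle_by_difference:
  fixes f :: "nat \<Rightarrow> nat \<Rightarrow> 'a :: comm_monoid_add"
  shows "(\<Sum>r = 1..n. \<Sum>k = 1..r. f r k) = (\<Sum>j = 1..n. \<Sum>k = 1..n - j + 1. f (j + k - 1) k)"
  unfolding sum.Sigma[OF finite_atLeastAtMost ballI[OF finite_atLeastAtMost]]
  by (rule sum.reindex_bij_witness[of _ "\<lambda>(j, k). (j + k - 1, k)" "\<lambda>(r, k). (r - k + 1, k)"]) auto

theorem mainTheorem9:
  fixes n :: nat
  assumes "n \<ge> 1"
  shows "(\<Sum>r = 1..n. euler (2 * r) / (fact (2 * r - 1) * fact (2 * (n - r + 1)))) =
    2 * (\<Sum>r = 1..n. \<Sum>k = 1..r.
      ((2 ^ (2 * k) - 1) * bernoulli (2 * k) * euler (2 * (r - k + 1))) /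
      (fact (2 * k) * fact (2 * (n - r) + 1) * fact (2 * (r - k) + 1)))"
proof -
  have "euler (2 * j) / (fact (2 * j - 1) * fact (2 * (n - j + 1))) =
      2 * (\<Sum>k = 1..n - j + 1.
        ((2 ^ (2 * k) - 1) * bernoulli (2 * k) * euler (2 * (j + k - 1 - k + 1))) /
        (fact (2 * k) * fact (2 * (n - (j + k - 1)) + 1) * fact (2 * (j + k - 1 - k) + 1)))"
    if j: "j \<in> {1..n}" for j
  proof -
    let ?m = "n - j + 1"
    define a where "a = euler (2 * j) / fact (2 * j - 1)"
    have "euler (2 * j) / (fact (2 * j - 1) * fact (2 * ?m)) =
        a * (1 / fact (2 * ?m))"
      by (simp add: a_def)
    also have "\<dots> = 2 * (\<Sum>k = 1..?m. a *
        ((2 ^ (2 * k) - 1) * bernoulli (2 * k) / (fact (2 * k) * fact (2 * (?m - k) + 1))))"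
      by (simp only: bernoulli_sinh_convolution[symmetric, of ?m, OF le_add2]
          mult.left_commute[of a 2] sum_distrib_left[of a])
    also have "(\<Sum>k = 1..?m. a *
          ((2 ^ (2 * k) - 1) * bernoulli (2 * k) / (fact (2 * k) * fact (2 * (?m - k) + 1)))) =
        (\<Sum>k = 1..?m.
          ((2 ^ (2 * k) - 1) * bernoulli (2 * k) * euler (2 * (j + k - 1 - k + 1))) /
          (fact (2 * k) * fact (2 * (n - (j + k - 1)) + 1) * fact (2 * (j + k - 1 - k) + 1)))"
    proof (rule sum.cong[OF refl])
      fix k
      assume k: "k \<in> {1..?m}"
      have "j + k - 1 - k + 1 = j" "n - (j + k - 1) = ?m - k" "2 * (j + k - 1 - k) + 1 = 2 * j - 1"
        using j k by auto
      then show "a *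
          ((2 ^ (2 * k) - 1) * bernoulli (2 * k) / (fact (2 * k) * fact (2 * (?m - k) + 1))) =
          ((2 ^ (2 * k) - 1) * bernoulli (2 * k) * euler (2 * (j + k - 1 - k + 1))) /
          (fact (2 * k) * fact (2 * (n - (j + k - 1)) + 1) * fact (2 * (j + k - 1 - k) + 1))"
        by (simp only: a_def times_divide_times_eq mult_ac)
    qed
    finally show ?thesis .
  qed
  then show ?thesis
    unfolding sum_triangle_by_difference sum_distrib_left[of 2 _ "{1..n}"]
    by (rule sum.cong[OF refl])
qed

end
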